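(* Let $D=(d_{ij})$ be an $n\times n$, $n\ge 4$, Euclidean distance matrix of embedding dimension $r\le n-2$, and let $Z$ and $P$ be, respectively, a Gale matrix and a configuration matrix of $D$, where $P^Te=0$. Let $(z^i)^T$ denote the $i$th row of $Z$, let $S=P(P^TP)^{-1}$, and let $(s^i)^T$ be the $i$th row of $S$. Let $k\neq l$ be indices in $\{1,\ldots,n\}$. If $z^k=z^l=0$, then the yielding interval of the entry $d_{kl}$ is $$\left[\frac{2}{\lambda_r},\ \frac{2}{\lambda_1}\right],$$ where $\lambda_1=(s^k)^Ts^l+\|s^k\|\,\|s^l\|$ and $\lambda_r=(s^k)^Ts^l-\|s^k\|\,\|s^l\|$.
   Context: An $n\times n$ real matrix $D=(d_{ij})$ is a Euclidean distance matrix (EDM) if there exist points $p^1,\ldots,p^n$ in some Euclidean space with $d_{ij}=\|p^i-p^j\|^2$ for all $i,j$; the dimension of the affine span of such points is the embedding dimension $r$ of $D$. For $i\ne j$, $E^{ij}$ is the $n\times n$ symmetric matrix with 1's in the $ij$th and $ji$th entries and 0's elsewhere. The yielding interval of an off-diagonal entry $d_{ij}$ is the closed interval $[l_{ij},u_{ij}]$ such that $D+tE^{ij}$ is an EDM if and only if $l_{ij}\le t\le u_{ij}$. Let $e\in\mathbb{R}^n$ be the all-ones vector, $J=I_n-ee^T/n$, and $B=-\frac12 JDJ$, which is positive semidefinite of rank $r$. A configuration matrix of $D$ is an $n\times r$ matrix $P$ with $B=PP^T$ (so $P$ has rank $r$ and $P^Te=0$); its rows $(p^1)^T,\ldots,(p^n)^T$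 give generating points of $D$. For $r\le n-2$, a Gale matrix of $D$ is an $n\times(n-r-1)$ matrix $Z$ whose columns form a basis of the null space of $\begin{bmatrix}P^T\\ e^T\end{bmatrix}$ (equivalently of $\begin{bmatrix}B\\ e^T\end{bmatrix}$). *)

theory Defs
  imports
    Complex_Main
    "Jordan_Normal_Form.Matrix_Kernel"
    "Jordan_Normal_Form.Gauss_Jordan_Elimination"
begin

text \<open>Indices run over \<open>0, \<dots>, n - 1\<close>; row \<open>i\<close> of a matrix is \<open>row A i\<close>.\<close>

definition ones_vec :: "nat \<Rightarrow> real vec" where
  "ones_vec n = vec n (\<lambda>_. 1)"

definition eucl_norm :: "real vec \<Rightarrow> real" where
  "eucl_norm v = sqrt (v \<bullet> v)"

text \<open>The points \<open>p 0, \<dots>, p (n - 1)\<close> of \<open>m\<close>-dimensional Euclidean space generate \<open>D\<close>.\<close>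

definition generating_points :: "nat \<Rightarrow> nat \<Rightarrow> (nat \<Rightarrow> real vec) \<Rightarrow> real mat \<Rightarrow> bool" where
  "generating_points n m p D \<longleftrightarrow>
     (\<forall>i<n. p i \<in> carrier_vec m) \<and>
     (\<forall>i<n. \<forall>j<n. D $$ (i, j) = (eucl_norm (p i - p j))\<^sup>2)"

definition is_EDM :: "nat \<Rightarrow> real mat \<Rightarrow> bool" where
  "is_EDM n D \<longleftrightarrow> D \<in> carrier_mat n n \<and> (\<exists>m p. generating_points n m p D)"

definition affine_span :: "nat \<Rightarrow> nat \<Rightarrow> (nat \<Rightarrow> real vec) \<Rightarrow> real vec set" where
  "affine_span n m p =
     {vec m (\<lambda>a. \<Sum>i<n. c i * p i $ a) | c :: nat \<Rightarrow> real. (\<Sum>i<n. c i) = 1}"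

text \<open>The dimension of a nonempty affine subspace \<open>A\<close> of \<open>m\<close>-space is that of its direction, the
  linear subspace of all differences of elements of \<open>A\<close>.\<close>

definition affine_dim :: "nat \<Rightarrow> real vec set \<Rightarrow> nat" where
  "affine_dim m A =
     vectorspace.dim class_ring
       ((module_vec TYPE(real) m)\<lparr>carrier := {x - y | x y. x \<in> A \<and> y \<in> A}\<rparr>)"

text \<open>The embedding dimension does not depend on the choice of the generating points, so it is
  rendered as a relation.\<close>

definition embedding_dim :: "nat \<Rightarrow> real mat \<Rightarrow> nat \<Rightarrow> bool" where
  "embedding_dim n D r \<longleftrightarrow>
     (\<exists>m p. generating_points n m p D \<and> affine_dim m (affine_span n m p) = r)"

definition unit_sym_mat :: "nat \<Rightarrow> nat \<Rightarrow> nat \<Rightarrow> real mat" where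
  "unit_sym_mat n i j =
     mat n n (\<lambda>(a, b). if (a = i \<and> b = j) \<or> (a = j \<and> b = i) then 1 else 0)"

definition is_yielding_interval :: "nat \<Rightarrow> real mat \<Rightarrow> nat \<Rightarrow> nat \<Rightarrow> real set \<Rightarrow> bool" where
  "is_yielding_interval n D i j I \<longleftrightarrow>
     (\<exists>l u. I = {l..u} \<and> (\<forall>t. is_EDM n (D + t \<cdot>\<^sub>m unit_sym_mat n i j) \<longleftrightarrow> l \<le> t \<and> t \<le> u))"

definition centering_mat :: "nat \<Rightarrow> real mat" where
  "centering_mat n =
     1\<^sub>m n - (1 / real n) \<cdot>\<^sub>m (mat_of_cols n [ones_vec n] * mat_of_rows n [ones_vec n])"

definition gram_mat :: "nat \<Rightarrow> real mat \<Rightarrow> real mat" where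
  "gram_mat n D = (- 1 / 2) \<cdot>\<^sub>m (centering_mat n * D * centering_mat n)"

definition is_configuration_mat :: "nat \<Rightarrow> nat \<Rightarrow> real mat \<Rightarrow> real mat \<Rightarrow> bool" where
  "is_configuration_mat n r D P \<longleftrightarrow>
     P \<in> carrier_mat n r \<and> gram_mat n D = P * transpose_mat P"

text \<open>Distinctness makes the list of columns, and not only the set of columns, a basis.  The null
  space of the stacked matrix is the same for every configuration matrix \<open>P\<close> of \<open>D\<close>, being the
  null space of the Gram matrix stacked on the transposed all-ones vector.\<close>

definition is_Gale_mat :: "nat \<Rightarrow> nat \<Rightarrow> real mat \<Rightarrow> real mat \<Rightarrow> bool" where
  "is_Gale_mat n r P Z \<longleftrightarrow>
     Z \<in> carrier_mat n (n - r - 1) \<and>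
     distinct (cols Z) \<and>
     kernel.basis n (transpose_mat P @\<^sub>r mat_of_rows n [ones_vec n]) (set (cols Z))"

end

theory Submission
  imports Defs
begin

text \<open>
  Write \<open>a = s\<^sup>k\<close>, \<open>b = s\<^sup>l\<close>, let \<open>p\<^sup>i\<close> be the rows of \<open>P\<close> and \<open>e\<close> the all-ones vector.  The two
  zero rows of \<open>Z\<close> say that the unit vectors \<open>e\<^sub>k\<close>, \<open>e\<^sub>l\<close> are orthogonal to the null space of \<open>P\<^sup>T\<close>
  stacked on \<open>e\<^sup>T\<close>, so they lie in the span of the columns of \<open>P\<close> and of \<open>e\<close>; explicitly
  \<open>P a = e\<^sub>k - e/n\<close> and \<open>P b = e\<^sub>l - e/n\<close>
  (\<open>zero_Gale_row_imp_unit_vec_in_range\<close>).  In coordinates, \<open>a \<bullet> p\<^sup>i\<close> is \<open>1\<close> at \<open>i = k\<close> and \<open>0\<close>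
  elsewhere, up to the constant \<open>1/n\<close>, which disappears in differences.  Hence
  \<open>(a \<bullet> (p\<^sup>i - p\<^sup>j)) (b \<bullet> (p\<^sup>i - p\<^sup>j))\<close> is \<open>-1\<close> for \<open>{i, j} = {k, l}\<close> and \<open>0\<close> otherwise: the entries of
  \<open>D + t E\<^sup>k\<^sup>l\<close> are the values \<open>q(p\<^sup>i - p\<^sup>j)\<close> of the quadratic form
  \<open>q(v) = |v|\<^sup>2 - t (a \<bullet> v) (b \<bullet> v)\<close>.

  If \<open>q\<close> is positive semidefinite, a square root of it moves the points \<open>p\<^sup>i\<close> to points that
  generate \<open>D + t E\<^sup>k\<^sup>l\<close> (\<open>rank_two_modification_EDM\<close>).  Conversely, a Euclidean distance matrix is
  negative semidefinite on vectors with entries summing to zero (\<open>EDM_negative_type\<close>), and on the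
  vector \<open>S v\<close> the matrix \<open>D + t E\<^sup>k\<^sup>l\<close> takes the value \<open>- 2 q(v)\<close>.  So the yielding interval consists
  of the \<open>t\<close> for which \<open>q\<close> is positive semidefinite.  The symmetric matrix of
  \<open>(a \<bullet> v) (b \<bullet> v)\<close> has the eigenvectors \<open>|b| a \<plusminus> |a| b\<close> with eigenvalues
  \<open>(a \<bullet> b \<plusminus> |a| |b|) / 2\<close>, all others being zero, and the condition on \<open>t\<close> becomes
  \<open>t \<lambda>\<^sub>1 \<le> 2\<close> and \<open>t \<lambda>\<^sub>r \<le> 2\<close>.  Finally \<open>a\<close> and \<open>b\<close> are linearly independent, because \<open>P a\<close> and \<open>P b\<close>
  are when \<open>n \<ge> 3\<close>, and the strict Cauchy-Schwarz inequality gives \<open>\<lambda>\<^sub>r < 0 < \<lambda>\<^sub>1\<close>.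
\<close>

section \<open>Real scalar products\<close>

lemma scalar_prod_self_ge_0: "0 \<le> v \<bullet> (v :: real vec)"
  unfolding scalar_prod_def by (auto intro!: sum_nonneg)

lemma scalar_prod_self_eq_0:
  assumes "v \<in> carrier_vec n" "v \<bullet> (v :: real vec) = 0"
  shows "v = 0\<^sub>v n"
proof -
  have "\<forall>i\<in>{0..<dim_vec v}. v $ i * v $ i = 0"
    using assms(2) unfolding scalar_prod_def
    by (subst (asm) sum_nonneg_eq_0_iff) auto
  thus ?thesis using assms(1) by (intro eq_vecI) auto
qed

lemma eucl_norm_sq: "(eucl_norm v)\<^sup>2 = v \<bullet> v"
  unfolding eucl_norm_def using scalar_prod_self_ge_0[of v] by simp

lemma eucl_norm_pos:
  assumes "v \<in> carrier_vec n" "v \<noteq> 0\<^sub>v n"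
  shows "0 < eucl_norm v"
  using scalar_prod_self_eq_0[of v n] assms scalar_prod_self_ge_0[of v]
  unfolding eucl_norm_def by fastforce

lemma scalar_prod_lincomb:
  assumes "a \<in> carrier_vec n" "b \<in> carrier_vec n" "v \<in> carrier_vec n"
  shows "(x \<cdot>\<^sub>v a + y \<cdot>\<^sub>v b) \<bullet> (v :: real vec) = x * (a \<bullet> v) + y * (b \<bullet> v)"
  using assms by (simp add: add_scalar_prod_distrib[of _ n])

lemma scalar_prod_lincomb_right:
  assumes "a \<in> carrier_vec n" "b \<in> carrier_vec n" "v \<in> carrier_vec n"
  shows "(v :: real vec) \<bullet> (x \<cdot>\<^sub>v a + y \<cdot>\<^sub>v b) = x * (v \<bullet> a) + y * (v \<bullet> b)"
  using assms by (simp add: scalar_prod_add_distrib[of _ n])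

lemma scalar_prod_lincomb_self:
  assumes "a \<in> carrier_vec n" "b \<in> carrier_vec n"
  shows "(x \<cdot>\<^sub>v a + y \<cdot>\<^sub>v b) \<bullet> (x \<cdot>\<^sub>v a + y \<cdot>\<^sub>v b)
    = x\<^sup>2 * (a \<bullet> a) + 2 * x * y * (a \<bullet> b) + y\<^sup>2 * (b \<bullet> (b :: real vec))"
  using assms scalar_prod_lincomb[OF assms, of "x \<cdot>\<^sub>v a + y \<cdot>\<^sub>v b" x y]
  by (simp add: scalar_prod_lincomb_right[of _ n] comm_scalar_prod[of b n a]
      power2_eq_square algebra_simps)

lemma smult_mat_mult_vec:
  assumes "A \<in> carrier_mat m n" "v \<in> carrier_vec n"
  shows "(c \<cdot>\<^sub>m A) *\<^sub>v v = c \<cdot>\<^sub>v (A *\<^sub>v (v :: real vec))"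
  using assms by (intro eq_vecI) auto

lemma mult_unit_vec:
  assumes "A \<in> carrier_mat m n" "j < n"
  shows "A *\<^sub>v unit_vec n j = col (A :: real mat) j"
  using assms by (intro eq_vecI) auto

text \<open>Strictness comes from the vector \<open>|b|\<^sup>2 a - (a \<bullet> b) b\<close>, whose square is
  \<open>|b|\<^sup>2 (|a|\<^sup>2 |b|\<^sup>2 - (a \<bullet> b)\<^sup>2)\<close> and which vanishes only for dependent \<open>a\<close>, \<open>b\<close>.\<close>

lemma strict_Cauchy_Schwarz:
  assumes a: "a \<in> carrier_vec n" and b: "b \<in> carrier_vec n"
    and indep: "\<And>x y. x \<cdot>\<^sub>v a + y \<cdot>\<^sub>v b = 0\<^sub>v n \<Longrightarrow> x = 0 \<and> y = (0::real)"
  shows "0 < eucl_norm a" "0 < eucl_norm b" "\<bar>a \<bullet> b\<bar> < eucl_norm a * eucl_norm b"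
proof -
  have z: "0 \<cdot>\<^sub>v v = 0\<^sub>v n" if "v \<in> carrier_vec n" for v :: "real vec"
    using that by (intro eq_vecI) auto
  have "a \<noteq> 0\<^sub>v n" using indep[of 1 0] a b z by auto
  thus na: "0 < eucl_norm a" by (rule eucl_norm_pos[OF a])
  have "b \<noteq> 0\<^sub>v n" using indep[of 0 1] a b z by auto
  thus nb: "0 < eucl_norm b" by (rule eucl_norm_pos[OF b])
  have bb: "b \<bullet> b > 0" using nb eucl_norm_sq[of b] by (metis zero_less_power)
  let ?v = "(b \<bullet> b) \<cdot>\<^sub>v a + (- (a \<bullet> b)) \<cdot>\<^sub>v b"
  have "?v \<noteq> 0\<^sub>v n" using indep[of "b \<bullet> b" "- (a \<bullet> b)"] bb by auto
  hence "?v \<bullet> ?v > 0"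
    using scalar_prod_self_eq_0[of ?v n] scalar_prod_self_ge_0[of ?v] a b by fastforce
  also have "?v \<bullet> ?v = (b \<bullet> b) * ((a \<bullet> a) * (b \<bullet> b) - (a \<bullet> b)\<^sup>2)"
    unfolding scalar_prod_lincomb_self[OF a b] by (simp add: power2_eq_square algebra_simps)
  finally have "(a \<bullet> b)\<^sup>2 < (a \<bullet> a) * (b \<bullet> b)" using bb by (simp add: zero_less_mult_iff)
  hence "\<bar>a \<bullet> b\<bar>\<^sup>2 < (eucl_norm a * eucl_norm b)\<^sup>2"
    by (simp add: power_mult_distrib eucl_norm_sq)
  thus "\<bar>a \<bullet> b\<bar> < eucl_norm a * eucl_norm b"
    by (rule power2_less_imp_less) (use na nb in simp)
qed

section \<open>Gale matrices and invertibility of the configuration's Gram matrix\<close>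

lemma mat_of_rows_single_mult:
  assumes "v \<in> carrier_vec n" "w \<in> carrier_vec n"
  shows "mat_of_rows n [w] *\<^sub>v (v :: real vec) = vec 1 (\<lambda>_. w \<bullet> v)"
  using assms by (intro eq_vecI) (auto simp: mat_of_rows_def row_def scalar_prod_def)

lemma zero_vec_append: "0\<^sub>v (m + n) = 0\<^sub>v m @\<^sub>v 0\<^sub>v n"
  by (intro eq_vecI) auto

text \<open>A vector in the null space of \<open>P\<^sup>T\<close> stacked on \<open>e\<^sup>T\<close> is a combination of the columns of \<open>Z\<close>, so
  orthogonality to \<open>w\<close> has to be tested on these columns only.\<close>

lemma Gale_span_orthogonal:
  assumes P: "P \<in> carrier_mat n r" and Z: "is_Gale_mat n r P Z"
    and x: "x \<in> carrier_vec n" "transpose_mat P *\<^sub>v x = 0\<^sub>v r" "ones_vec n \<bullet> x = 0"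
    and w: "w \<in> carrier_vec n" "transpose_mat Z *\<^sub>v w = 0\<^sub>v (n - r - 1)"
  shows "x \<bullet> w = 0"
proof -
  let ?O = "mat_of_rows n [ones_vec n]"
  let ?A = "transpose_mat P @\<^sub>r ?O"
  have o: "ones_vec n \<in> carrier_vec n" by (simp add: ones_vec_def)
  have O: "?O \<in> carrier_mat 1 n" by (simp add: mat_of_rows_def)
  have A: "?A \<in> carrier_mat (r + 1) n" using P O by (intro carrier_append_rows) auto
  interpret kernel "r + 1" n ?A by unfold_locales (rule A)
  have Zc: "Z \<in> carrier_mat n (n - r - 1)" and bas: "basis (set (cols Z))"
    using Z unfolding is_Gale_mat_def by auto
  have sub: "set (cols Z) \<subseteq> mat_kernel ?A" and gen: "span (set (cols Z)) = mat_kernel ?A"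
    using bas unfolding Ker.basis_def by auto
  have "?A *\<^sub>v x = 0\<^sub>v r @\<^sub>v 0\<^sub>v 1"
    using P by (subst mat_mult_append[OF _ O x(1)], simp)
      (simp add: x(2) mat_of_rows_single_mult[OF x(1) o] x(3), auto)
  also have "\<dots> = 0\<^sub>v (r + 1)" by auto
  finally have "x \<in> mat_kernel ?A" by (rule mat_kernelI[OF A x(1)])
  hence "x \<in> span (set (cols Z))" using gen by simp
  then obtain c U where U: "finite U" "U \<subseteq> set (cols Z)" and xl: "x = lincomb c U"
    unfolding Ker.span_def by auto
  have Uw: "s \<bullet> w = 0" if "s \<in> U" for s
  proof -
    from that U(2) Zc obtain j where j: "j < n - r - 1" "s = col Z j"
      by (auto simp: cols_def)
    have "s \<bullet> w = (transpose_mat Z *\<^sub>v w) $ j" using j Zc by simp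
    thus ?thesis using w(2) j by simp
  qed
  have Uc: "s \<in> carrier_vec n" if "s \<in> U" for s
    using that U(2) sub mat_kernel_carrier[OF A] by auto
  have "x \<bullet> w = (\<Sum>i<n. (\<Sum>s\<in>U. c s * s $ i) * w $ i)"
    using w(1) lincomb_index[of _ U c] U(2) sub xl
    by (auto simp: scalar_prod_def lessThan_atLeast0 intro!: sum.cong)
  also have "\<dots> = (\<Sum>s\<in>U. c s * (\<Sum>i<n. s $ i * w $ i))"
    by (simp add: sum_distrib_right sum_distrib_left mult.assoc) (rule sum.swap)
  also have "\<dots> = (\<Sum>s\<in>U. c s * (s \<bullet> w))"
    using w(1) by (auto simp: scalar_prod_def lessThan_atLeast0 intro!: sum.cong)
  also have "\<dots> = 0" using Uw by simp
  finally show ?thesis .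
qed

text \<open>The rank of \<open>P\<close> can be read off from the number \<open>n - r - 1\<close> of columns of \<open>Z\<close>, which makes the matrix
  \<open>H\<close> of \<open>P\<^sup>T\<close>, \<open>e\<^sup>T\<close> and \<open>Z\<^sup>T\<close> on top of each other square.  If \<open>H x = 0\<close>, then \<open>x\<close> lies in the span of the columns
  of \<open>Z\<close> and is orthogonal to them, so \<open>x = 0\<close>.  Hence \<open>H\<close> is invertible and so is \<open>H\<^sup>T\<close>, whose first
  \<open>r\<close> columns are those of \<open>P\<close>.\<close>

lemma configuration_injective:
  assumes P: "P \<in> carrier_mat n r" and rn: "r \<le> n - 2" "2 \<le> n" and Z: "is_Gale_mat n r P Z"
    and y: "y \<in> carrier_vec r" "P *\<^sub>v y = 0\<^sub>v n"
  shows "y = 0\<^sub>v r"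
proof (rule ccontr)
  assume y0: "y \<noteq> 0\<^sub>v r"
  define m where "m = n - r - 1"
  have dim: "r + 1 + m = n" unfolding m_def using rn by linarith
  define U where "U = mat_of_rows n [ones_vec n]"
  define A where "A = transpose_mat P @\<^sub>r U"
  define H where "H = A @\<^sub>r transpose_mat Z"
  define u where "u = (y @\<^sub>v 0\<^sub>v 1) @\<^sub>v 0\<^sub>v m"
  have o: "ones_vec n \<in> carrier_vec n" by (simp add: ones_vec_def)
  have U: "U \<in> carrier_mat 1 n" unfolding U_def by (simp add: mat_of_rows_def)
  have PT: "transpose_mat P \<in> carrier_mat r n" using P by simp
  have A: "A \<in> carrier_mat (r + 1) n" unfolding A_def using PT U by (rule carrier_append_rows)
  have "Z \<in> carrier_mat n m" using Z unfolding is_Gale_mat_def m_def by blast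
  hence ZT: "transpose_mat Z \<in> carrier_mat m n" by simp
  have H: "H \<in> carrier_mat n n" unfolding H_def using carrier_append_rows[OF A ZT] unfolding dim .
  have HT: "transpose_mat H \<in> carrier_mat n n" using H by simp
  have Hx: "H *\<^sub>v x = ((transpose_mat P *\<^sub>v x) @\<^sub>v vec 1 (\<lambda>_. ones_vec n \<bullet> x))
      @\<^sub>v (transpose_mat Z *\<^sub>v x)" if x: "x \<in> carrier_vec n" for x
    unfolding H_def mat_mult_append[OF A ZT x]
    unfolding A_def mat_mult_append[OF PT U x]
    unfolding U_def mat_of_rows_single_mult[OF x o] ..
  have y1: "y @\<^sub>v 0\<^sub>v 1 \<in> carrier_vec (r + 1)"
    by (rule append_carrier_vec[OF y(1) zero_carrier_vec])
  have uc: "u \<in> carrier_vec n"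
    unfolding u_def using append_carrier_vec[OF y1 zero_carrier_vec[of m]] unfolding dim .
  have zero: "0\<^sub>v n = (0\<^sub>v r @\<^sub>v 0\<^sub>v 1) @\<^sub>v (0\<^sub>v m :: real vec)"
    unfolding dim[symmetric] zero_vec_append ..
  have u0: "u \<noteq> 0\<^sub>v n"
  proof
    assume "u = 0\<^sub>v n"
    hence "y @\<^sub>v 0\<^sub>v 1 = 0\<^sub>v r @\<^sub>v 0\<^sub>v 1"
      unfolding u_def zero using append_vec_eq[OF y1, of "0\<^sub>v r @\<^sub>v 0\<^sub>v 1"]
      by (metis append_carrier_vec zero_carrier_vec)
    thus False using append_vec_eq[OF y(1) zero_carrier_vec] y0 by metis
  qed
  \<comment> \<open>\<open>u\<close> is \<open>y\<close> padded with zeros, and \<open>H\<^sup>T u = P y = 0\<close>.\<close>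
  have uH: "u \<bullet> (H *\<^sub>v x) = 0" if x: "x \<in> carrier_vec n" for x
  proof -
    have Px: "transpose_mat P *\<^sub>v x \<in> carrier_vec r" and Zx: "transpose_mat Z *\<^sub>v x \<in> carrier_vec m"
      using PT ZT by (auto intro!: carrier_vecI)
    have v1: "vec 1 (\<lambda>_. ones_vec n \<bullet> x) \<in> carrier_vec 1" by (rule vec_carrier)
    have "u \<bullet> (H *\<^sub>v x) = y \<bullet> (transpose_mat P *\<^sub>v x)
        + 0\<^sub>v 1 \<bullet> vec 1 (\<lambda>_. ones_vec n \<bullet> x) + 0\<^sub>v m \<bullet> (transpose_mat Z *\<^sub>v x)"
      unfolding Hx[OF x] u_def
        scalar_prod_append[OF y1 zero_carrier_vec append_carrier_vec[OF Px v1] Zx]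
        scalar_prod_append[OF y(1) zero_carrier_vec Px v1] ..
    also have "\<dots> = y \<bullet> (transpose_mat P *\<^sub>v x)"
      unfolding scalar_prod_left_zero[OF v1] scalar_prod_left_zero[OF Zx] by simp
    also have "\<dots> = (P *\<^sub>v y) \<bullet> x"
      using transpose_vec_mult_scalar[OF PT x y(1)] by simp
    finally show ?thesis using y(2) x by simp
  qed
  have Hu: "transpose_mat H *\<^sub>v u \<in> carrier_vec n" by (rule mult_mat_vec_carrier[OF HT uc])
  have "(transpose_mat H *\<^sub>v u) \<bullet> (transpose_mat H *\<^sub>v u) = 0"
    unfolding transpose_vec_mult_scalar[OF H Hu uc] by (rule uH[OF Hu])
  hence "transpose_mat H *\<^sub>v u = 0\<^sub>v n" by (rule scalar_prod_self_eq_0[OF Hu])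
  hence "det (transpose_mat H) = 0"
    using det_0_iff_vec_prod_zero_field[OF HT] uc u0 by blast
  hence "det H = 0" using det_transpose[OF H] by simp
  then obtain x where x: "x \<in> carrier_vec n" "x \<noteq> 0\<^sub>v n" "H *\<^sub>v x = 0\<^sub>v n"
    using det_0_iff_vec_prod_zero_field[OF H] by blast
  have Px: "transpose_mat P *\<^sub>v x \<in> carrier_vec r" by (rule mult_mat_vec_carrier[OF PT x(1)])
  have v1: "vec 1 (\<lambda>_. ones_vec n \<bullet> x) \<in> carrier_vec 1" by (rule vec_carrier)
  have z1: "(transpose_mat P *\<^sub>v x) @\<^sub>v vec 1 (\<lambda>_. ones_vec n \<bullet> x) = 0\<^sub>v r @\<^sub>v 0\<^sub>v 1"
    and z2: "transpose_mat Z *\<^sub>v x = 0\<^sub>v m"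
    using x(3) append_vec_eq[OF append_carrier_vec[OF Px v1]
        append_carrier_vec[OF zero_carrier_vec zero_carrier_vec]]
    unfolding Hx[OF x(1)] zero by blast+
  have z3: "transpose_mat P *\<^sub>v x = 0\<^sub>v r" and z4: "vec 1 (\<lambda>_. ones_vec n \<bullet> x) = 0\<^sub>v 1"
    using z1 append_vec_eq[OF Px zero_carrier_vec] by blast+
  have "ones_vec n \<bullet> x = 0" using arg_cong[OF z4, of "\<lambda>v. v $ 0"] by simp
  hence "x \<bullet> x = 0" by (rule Gale_span_orthogonal[OF P Z x(1) z3 _ x(1) z2[unfolded m_def]])
  thus False using scalar_prod_self_eq_0[OF x(1)] x(2) by simp
qed

lemma injective_imp_gram_inverse:
  fixes P :: "real mat"
  assumes P: "P \<in> carrier_mat n r"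
    and inj: "\<And>y. y \<in> carrier_vec r \<Longrightarrow> P *\<^sub>v y = 0\<^sub>v n \<Longrightarrow> y = 0\<^sub>v r"
  defines "Q \<equiv> the (mat_inverse (transpose_mat P * P))"
  shows "Q \<in> carrier_mat r r" "transpose_mat P * P * Q = 1\<^sub>m r" "Q * (transpose_mat P * P) = 1\<^sub>m r"
proof -
  let ?G = "transpose_mat P * P"
  have G: "?G \<in> carrier_mat r r" using P by auto
  have "det ?G \<noteq> 0"
  proof
    assume "det ?G = 0"
    then obtain y where y: "y \<in> carrier_vec r" "y \<noteq> 0\<^sub>v r" "?G *\<^sub>v y = 0\<^sub>v r"
      using det_0_iff_vec_prod_zero_field[OF G] by auto
    have Py: "P *\<^sub>v y \<in> carrier_vec n" using P y by auto
    have "transpose_mat P *\<^sub>v (P *\<^sub>v y) = 0\<^sub>v r"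
      using y P by (metis assoc_mult_mat_vec transpose_carrier_mat)
    hence "(P *\<^sub>v y) \<bullet> (P *\<^sub>v y) = 0"
      using transpose_vec_mult_scalar[OF P y(1) Py] y(1) by simp
    hence "P *\<^sub>v y = 0\<^sub>v n" by (rule scalar_prod_self_eq_0[OF Py])
    thus False using inj y by blast
  qed
  hence "?G \<in> Units (ring_mat TYPE(real) r ())" by (rule det_non_zero_imp_unit[OF G])
  then obtain B where B: "mat_inverse ?G = Some B"
    using mat_inverse(1)[OF G, where b = "()"] by (cases "mat_inverse ?G") auto
  show "Q \<in> carrier_mat r r" "?G * Q = 1\<^sub>m r" "Q * ?G = 1\<^sub>m r"
    using mat_inverse(2)[OF G B] B unfolding Q_def by auto
qed

text \<open>The residual \<open>w\<close> of the projection of \<open>e\<^sub>k\<close> to the span of the columns of \<open>P\<close> and of \<open>e\<close> is annihilated by \<open>P\<^sup>T\<close> and \<open>e\<^sup>T\<close>, hence is a combination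
  of columns of \<open>Z\<close> and has \<open>k\<close>-th entry zero.  By orthogonality of
  the projection this entry is also \<open>w \<bullet> w\<close>.\<close>

lemma zero_Gale_row_imp_unit_vec_in_range:
  assumes P: "P \<in> carrier_mat n r" and Z: "is_Gale_mat n r P Z"
    and Pe: "transpose_mat P *\<^sub>v ones_vec n = 0\<^sub>v r"
    and Q: "Q \<in> carrier_mat r r" "Q * (transpose_mat P * P) = 1\<^sub>m r"
    and k: "k < n" and zk: "row Z k = 0\<^sub>v (n - r - 1)"
  shows "P *\<^sub>v row (P * Q) k = unit_vec n k - (1 / real n) \<cdot>\<^sub>v ones_vec n"
proof -
  let ?s = "row (P * Q) k" and ?e = "ones_vec n"
  let ?w = "unit_vec n k - (1 / real n) \<cdot>\<^sub>v ?e - P *\<^sub>v ?s"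
  have Zc: "Z \<in> carrier_mat n (n - r - 1)" using Z unfolding is_Gale_mat_def by auto
  have PT: "transpose_mat P \<in> carrier_mat r n" using P by simp
  have e: "?e \<in> carrier_vec n" by (simp add: ones_vec_def)
  have ee: "?e \<bullet> ?e = real n" by (simp add: ones_vec_def scalar_prod_def)
  have ek: "?e \<bullet> unit_vec n k = 1" using k by (simp add: ones_vec_def)
  have s: "?s \<in> carrier_vec r" using P Q(1) k by (intro row_carrier_vec[of _ n]) auto
  have Ps: "P *\<^sub>v ?s \<in> carrier_vec n" using P s by auto
  have w: "?w \<in> carrier_vec n" using e Ps by auto
  have s_eq: "?s = transpose_mat Q *\<^sub>v row P k"
    using P Q k by (intro eq_vecI) (auto simp: comm_scalar_prod[of _ r])
  have QG: "transpose_mat P * P * transpose_mat Q = 1\<^sub>m r"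
  proof -
    have G: "transpose_mat P * P \<in> carrier_mat r r" using P by auto
    have "transpose_mat (Q * (transpose_mat P * P))
        = transpose_mat (transpose_mat P * P) * transpose_mat Q"
      by (rule transpose_mult[OF Q(1) G])
    also have "transpose_mat (transpose_mat P * P) = transpose_mat P * P"
      using transpose_mult[OF PT P] by simp
    finally show ?thesis using Q(2) by simp
  qed
  have PPs: "transpose_mat P *\<^sub>v (P *\<^sub>v ?s) = row P k"
  proof -
    have "transpose_mat P *\<^sub>v (P *\<^sub>v ?s) = (transpose_mat P * P) *\<^sub>v (transpose_mat Q *\<^sub>v row P k)"
      unfolding s_eq using P Q k by (intro assoc_mult_mat_vec[symmetric, of _ r n]) auto
    also have "\<dots> = (transpose_mat P * P * transpose_mat Q) *\<^sub>v row P k"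
      using P Q k by (intro assoc_mult_mat_vec[symmetric, of _ r r _ r]) auto
    also have "\<dots> = row P k" unfolding QG using P k by auto
    finally show ?thesis .
  qed
  have Pk: "transpose_mat P *\<^sub>v unit_vec n k = row P k"
    using P k by (intro eq_vecI) auto
  have Pw: "transpose_mat P *\<^sub>v ?w = 0\<^sub>v r"
    using P e Ps k
    by (auto simp: mult_minus_distrib_mat_vec[OF PT] mult_mat_vec[OF PT] Pk PPs Pe intro!: eq_vecI)
  have eP: "?e \<bullet> (P *\<^sub>v ?s) = 0"
    using transpose_vec_mult_scalar[OF P s e] Pe s by simp
  have ew: "?e \<bullet> ?w = 0"
    using e Ps k eP ee ek by (simp add: scalar_prod_minus_distrib[of _ n])
  have Zk: "transpose_mat Z *\<^sub>v unit_vec n k = 0\<^sub>v (n - r - 1)"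
    using zk Zc k by (intro eq_vecI) (auto simp: vec_eq_iff)
  have wk: "?w \<bullet> unit_vec n k = 0"
    by (rule Gale_span_orthogonal[OF P Z w Pw ew _ Zk]) simp
  have "?w \<bullet> (P *\<^sub>v ?s) = 0"
    using transpose_vec_mult_scalar[OF P s w] Pw s by simp
  moreover have "?w \<bullet> ?e = 0" using ew comm_scalar_prod[OF w e] by simp
  ultimately have "?w \<bullet> ?w = 0"
    using scalar_prod_minus_distrib[OF w _ Ps, of "unit_vec n k - (1 / real n) \<cdot>\<^sub>v ?e"]
      scalar_prod_minus_distrib[OF w, of "unit_vec n k" "(1 / real n) \<cdot>\<^sub>v ?e"] wk e w
    by (simp del: scalar_prod_right_unit)
  hence "?w = 0\<^sub>v n" by (rule scalar_prod_self_eq_0[OF w])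
  thus ?thesis using e Ps by (auto simp: vec_eq_iff)
qed

section \<open>Distance matrices on sum-zero vectors\<close>

lemma quadratic_form_sum:
  assumes "D \<in> carrier_mat n n" "x \<in> carrier_vec n"
  shows "x \<bullet> (D *\<^sub>v x) = (\<Sum>i<n. \<Sum>j<n. x $ i * x $ j * (D $$ (i, j) :: real))"
  using assms
  by (auto simp: scalar_prod_def lessThan_atLeast0 sum_distrib_left mult_ac intro!: sum.cong)

text \<open>In \<open>\<Sum> x\<^sub>i x\<^sub>j |q\<^sub>i - q\<^sub>j|\<^sup>2\<close> the terms \<open>|q\<^sub>i|\<^sup>2\<close> and \<open>|q\<^sub>j|\<^sup>2\<close> are killed by \<open>\<Sum> x\<^sub>i = 0\<close>, which leaves
  \<open>- 2 |\<Sum> x\<^sub>i q\<^sub>i|\<^sup>2\<close>.\<close>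

lemma EDM_negative_type:
  assumes D: "is_EDM n D" and x: "x \<in> carrier_vec n" "ones_vec n \<bullet> x = 0"
  shows "x \<bullet> (D *\<^sub>v x) \<le> 0"
proof -
  from D obtain m q where Dc: "D \<in> carrier_mat n n" and gp: "generating_points n m q D"
    unfolding is_EDM_def by auto
  have q: "q i \<in> carrier_vec m" if "i < n" for i
    using gp that unfolding generating_points_def by auto
  have Dq: "D $$ (i, j) = q i \<bullet> q i + q j \<bullet> q j - 2 * (\<Sum>a<m. q i $ a * q j $ a)"
    if ij: "i < n" "j < n" for i j
  proof -
    have "D $$ (i, j) = (q i - q j) \<bullet> (q i - q j)"
      using gp ij unfolding generating_points_def eucl_norm_sq by auto
    also have "\<dots> = q i \<bullet> q i + q j \<bullet> q j - 2 * (q i \<bullet> q j)"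
      using q[OF ij(1)] q[OF ij(2)]
      by (simp add: scalar_prod_minus_distrib[of _ m] minus_scalar_prod_distrib[of _ m]
          comm_scalar_prod[of "q j" m "q i"])
    also have "q i \<bullet> q j = (\<Sum>a<m. q i $ a * q j $ a)"
      using q[OF ij(2)] by (simp add: scalar_prod_def lessThan_atLeast0)
    finally show ?thesis .
  qed
  have sx: "(\<Sum>i<n. x $ i) = 0"
    using x by (auto simp: scalar_prod_def ones_vec_def lessThan_atLeast0)
  have "x \<bullet> (D *\<^sub>v x) = (\<Sum>i<n. \<Sum>j<n. x $ i * x $ j *
      (q i \<bullet> q i + q j \<bullet> q j - 2 * (\<Sum>a<m. q i $ a * q j $ a)))"
    unfolding quadratic_form_sum[OF Dc x(1)] using Dq by (intro sum.cong refl) auto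
  also have "\<dots> = (\<Sum>i<n. \<Sum>j<n. (x $ i * (q i \<bullet> q i)) * x $ j)
      + (\<Sum>i<n. \<Sum>j<n. x $ i * (x $ j * (q j \<bullet> q j)))
      - 2 * (\<Sum>i<n. \<Sum>j<n. \<Sum>a<m. (x $ i * q i $ a) * (x $ j * q j $ a))"
    by (simp add: sum.distrib sum_subtractf algebra_simps sum_distrib_left)
  also have "(\<Sum>i<n. \<Sum>j<n. (x $ i * (q i \<bullet> q i)) * x $ j) = 0"
    by (simp add: sum_distrib_left[symmetric] sx)
  also have "(\<Sum>i<n. \<Sum>j<n. x $ i * (x $ j * (q j \<bullet> q j))) = 0"
    by (simp add: sum_distrib_left[symmetric] sum_distrib_right[symmetric] sx)
  also have "(\<Sum>i<n. \<Sum>j<n. \<Sum>a<m. (x $ i * q i $ a) * (x $ j * q j $ a))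
      = (\<Sum>i<n. \<Sum>a<m. \<Sum>j<n. (x $ i * q i $ a) * (x $ j * q j $ a))"
    by (rule sum.cong[OF refl], rule sum.swap)
  also have "\<dots> = (\<Sum>a<m. \<Sum>i<n. \<Sum>j<n. (x $ i * q i $ a) * (x $ j * q j $ a))"
    by (rule sum.swap)
  also have "\<dots> = (\<Sum>a<m. (\<Sum>i<n. x $ i * q i $ a)\<^sup>2)"
    by (simp only: power2_eq_square sum_product)
  finally show ?thesis by (simp add: sum_nonneg)
qed

text \<open>A sum-zero vector is fixed by \<open>J\<close>, which therefore disappears from the Gram matrix.\<close>

lemma configuration_quadratic_form:
  assumes D: "D \<in> carrier_mat n n" and P: "is_configuration_mat n r D P"
    and x: "x \<in> carrier_vec n" "ones_vec n \<bullet> x = 0"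
  shows "x \<bullet> (D *\<^sub>v x) = - 2 * ((transpose_mat P *\<^sub>v x) \<bullet> (transpose_mat P *\<^sub>v x))"
proof -
  let ?J = "centering_mat n"
  let ?o = "ones_vec n"
  have Pc: "P \<in> carrier_mat n r" and G: "gram_mat n D = P * transpose_mat P"
    using P unfolding is_configuration_mat_def by auto
  have PT: "transpose_mat P \<in> carrier_mat r n" using Pc by simp
  have J: "?J \<in> carrier_mat n n" unfolding centering_mat_def by (auto simp: mat_of_rows_def mat_of_cols_def)
  have Jij: "?J $$ (i, j) = (if i = j then 1 else 0) - 1 / real n" if "i < n" "j < n" for i j
    using that unfolding centering_mat_def ones_vec_def
    by (auto simp: mat_of_rows_def mat_of_cols_def scalar_prod_def)
  have JT: "transpose_mat ?J = ?J"
    using J by (intro eq_matI) (auto simp: Jij)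
  have sx: "(\<Sum>i<n. x $ i) = 0"
    using x by (auto simp: scalar_prod_def ones_vec_def lessThan_atLeast0)
  have Jx: "?J *\<^sub>v x = x"
  proof (rule eq_vecI)
    fix i assume "i < dim_vec x"
    hence i: "i < n" using x by auto
    have "(?J *\<^sub>v x) $ i = (\<Sum>j<n. ((if i = j then 1 else 0) - 1 / real n) * x $ j)"
      using i J x Jij by (auto simp: scalar_prod_def lessThan_atLeast0 intro!: sum.cong)
    also have "\<dots> = (\<Sum>j<n. (if i = j then x $ j else 0)) - 1 / real n * (\<Sum>j<n. x $ j)"
      unfolding sum_distrib_left sum_subtractf[symmetric]
      by (intro sum.cong refl) (auto simp: algebra_simps)
    also have "\<dots> = x $ i" using i by (simp add: sx)
    finally show "(?J *\<^sub>v x) $ i = x $ i" .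
  qed (use J x in auto)
  have "(transpose_mat P *\<^sub>v x) \<bullet> (transpose_mat P *\<^sub>v x) = x \<bullet> (P *\<^sub>v (transpose_mat P *\<^sub>v x))"
    by (rule transpose_vec_mult_scalar[OF Pc _ x(1)]) (use PT x in auto)
  also have "P *\<^sub>v (transpose_mat P *\<^sub>v x) = gram_mat n D *\<^sub>v x"
    unfolding G by (rule assoc_mult_mat_vec[symmetric, OF Pc PT x(1)])
  also have "\<dots> = (- 1 / 2) \<cdot>\<^sub>v (?J * D * ?J *\<^sub>v x)"
    unfolding gram_mat_def using J D x by (intro smult_mat_mult_vec[of _ n n]) auto
  also have "?J * D * ?J *\<^sub>v x = ?J *\<^sub>v (D *\<^sub>v x)"
    using J D x Jx by (metis assoc_mult_mat_vec mult_carrier_mat)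
  also have "x \<bullet> ((- 1 / 2) \<cdot>\<^sub>v (?J *\<^sub>v (D *\<^sub>v x))) = (- 1 / 2) * (x \<bullet> (?J *\<^sub>v (D *\<^sub>v x)))"
    using x J D by (intro scalar_prod_smult_distrib) auto
  also have "x \<bullet> (?J *\<^sub>v (D *\<^sub>v x)) = x \<bullet> (D *\<^sub>v x)"
    using transpose_vec_mult_scalar[OF J _ x(1), of "D *\<^sub>v x"] JT Jx D x by auto
  finally show ?thesis by simp
qed

text \<open>The quadratic form is evaluated at \<open>e\<^sub>i - e\<^sub>j\<close>.\<close>

lemma configuration_generating_points:
  assumes D: "is_EDM n D" and P: "is_configuration_mat n r D P"
  shows "generating_points n r (row P) D"
  unfolding generating_points_def eucl_norm_sq
proof (intro conjI allI impI)
  have Dc: "D \<in> carrier_mat n n" using D unfolding is_EDM_def by auto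
  have Pc: "P \<in> carrier_mat n r" using P unfolding is_configuration_mat_def by auto
  have PT: "transpose_mat P \<in> carrier_mat r n" using Pc by simp
  show "row P i \<in> carrier_vec r" if "i < n" for i using Pc that by auto
  fix i j assume ij: "i < n" "j < n"
  let ?x = "unit_vec n i - unit_vec n j :: real vec"
  have x: "?x \<in> carrier_vec n" by simp
  have o: "ones_vec n \<in> carrier_vec n" by (simp add: ones_vec_def)
  have ox: "ones_vec n \<bullet> ?x = 0"
    using ij o by (simp add: scalar_prod_minus_distrib[of _ n] ones_vec_def)
  have u: "transpose_mat P *\<^sub>v unit_vec n a = row P a" if "a < n" for a
    using Pc that by (intro eq_vecI) auto
  have Px: "transpose_mat P *\<^sub>v ?x = row P i - row P j"
    using ij by (simp add: mult_minus_distrib_mat_vec[OF PT] u)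
  have sym: "D $$ (a, b) = D $$ (b, a)" "D $$ (a, a) = 0" if "a < n" "b < n" for a b
  proof -
    obtain m q where q: "generating_points n m q D" using D unfolding is_EDM_def by auto
    have qa: "q a \<in> carrier_vec m" "q b \<in> carrier_vec m" using q that unfolding generating_points_def by auto
    show "D $$ (a, b) = D $$ (b, a)" "D $$ (a, a) = 0"
      using q that qa unfolding generating_points_def eucl_norm_sq
      by (auto simp: scalar_prod_minus_distrib[of _ m] minus_scalar_prod_distrib[of _ m] comm_scalar_prod[of "q b" m "q a"])
  qed
  have "D *\<^sub>v ?x = col D i - col D j"
    using ij Dc by (simp add: mult_minus_distrib_mat_vec[OF Dc] mult_unit_vec[OF Dc])
  hence "?x \<bullet> (D *\<^sub>v ?x) = D $$ (i, i) - D $$ (i, j) - D $$ (j, i) + D $$ (j, j)"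
    using ij Dc by (simp add: minus_scalar_prod_distrib[of _ n] scalar_prod_minus_distrib[of _ n])
  also have "\<dots> = - 2 * D $$ (i, j)" using sym[OF ij] sym[OF ij(2) ij(1)] by simp
  finally show "D $$ (i, j) = (row P i - row P j) \<bullet> (row P i - row P j)"
    using configuration_quadratic_form[OF Dc P x ox] unfolding Px by simp
qed

section \<open>Rank-two modification of a point configuration\<close>

text \<open>The number \<open>d\<close> makes \<open>I - d f f\<^sup>T\<close> a square root of \<open>I - c f f\<^sup>T\<close>, where \<open>m = |f|\<^sup>2\<close>.\<close>

lemma rank_one_square_root_coefficient:
  assumes "0 \<le> m" "c * m \<le> (1 :: real)"
  shows "\<exists>d. 2 * d - d\<^sup>2 * m = c"
proof (cases "m = 0")
  case True
  thus ?thesis by (intro exI[of _ "c / 2"]) simp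
next
  case False
  define w where "w = sqrt (1 - c * m)"
  have w2: "w\<^sup>2 = 1 - c * m" unfolding w_def using assms by simp
  have "2 * ((1 - w) / m) - ((1 - w) / m)\<^sup>2 * m = (1 - w\<^sup>2) / m"
    using False by (simp add: field_simps power2_eq_square)
  also have "\<dots> = c" using False by (simp add: w2)
  finally show ?thesis by blast
qed

text \<open>With \<open>f = |b| a + |a| b\<close> and \<open>g = |b| a - |a| b\<close> one has
  \<open>4 |a| |b| (a \<bullet> v) (b \<bullet> v) = (f \<bullet> v)\<^sup>2 - (g \<bullet> v)\<^sup>2\<close>.  For \<open>t \<ge> 0\<close> the square of \<open>g \<bullet> v\<close> enters
  \<open>|v|\<^sup>2 - t (a \<bullet> v) (b \<bullet> v)\<close> with a positive sign and is realised by one additional coordinate; the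
  remaining form \<open>|v|\<^sup>2 - c (f \<bullet> v)\<^sup>2\<close> has a square root if \<open>c |f|\<^sup>2 \<le> 1\<close>, which is the bound on \<open>t\<close>.
  The new points are the images of the old ones under the resulting linear map \<open>h\<close>.\<close>

lemma rank_two_modification_EDM_nonneg:
  assumes p: "\<And>i. i < n \<Longrightarrow> p i \<in> carrier_vec r"
    and a: "a \<in> carrier_vec r" and b: "b \<in> carrier_vec r"
    and na: "0 < eucl_norm a" and nb: "0 < eucl_norm b"
    and t: "0 \<le> t" "t * (a \<bullet> b + eucl_norm a * eucl_norm b) \<le> 2"
    and D': "D' \<in> carrier_mat n n"
    and entries: "\<And>i j. i < n \<Longrightarrow> j < n \<Longrightarrow> D' $$ (i, j) =
      (p i - p j) \<bullet> (p i - p j) - t * (a \<bullet> (p i - p j)) * (b \<bullet> (p i - p j))"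
  shows "is_EDM n D'"
proof -
  define N M where "N = eucl_norm a" and "M = eucl_norm b"
  define f g where "f = M \<cdot>\<^sub>v a + N \<cdot>\<^sub>v b" and "g = M \<cdot>\<^sub>v a + (- N) \<cdot>\<^sub>v b"
  define c where "c = t / (4 * (N * M))"
  have NM: "0 < N" "0 < M" using na nb unfolding N_def M_def by auto
  have c0: "0 \<le> c" unfolding c_def using t NM by simp
  have f: "f \<in> carrier_vec r" and g: "g \<in> carrier_vec r" unfolding f_def g_def using a b by auto
  have ff: "f \<bullet> f = 2 * (N * M) * (a \<bullet> b + N * M)"
    unfolding f_def scalar_prod_lincomb_self[OF a b]
    unfolding eucl_norm_sq[symmetric] N_def[symmetric] M_def[symmetric]
    by (simp add: power2_eq_square algebra_simps)
  have "c * (f \<bullet> f) = t * (a \<bullet> b + N * M) / 2"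
    unfolding ff c_def using NM by (simp add: field_simps)
  also have "\<dots> \<le> 1" using t unfolding N_def M_def by simp
  finally obtain d where d: "2 * d - d\<^sup>2 * (f \<bullet> f) = c"
    using rank_one_square_root_coefficient[OF scalar_prod_self_ge_0] by blast
  define h where "h v = (v + (- (d * (f \<bullet> v))) \<cdot>\<^sub>v f) @\<^sub>v vec 1 (\<lambda>_. sqrt c * (g \<bullet> v))" for v
  have h: "h v \<in> carrier_vec (r + 1)" if "v \<in> carrier_vec r" for v
    unfolding h_def using that f by (intro append_carrier_vec) auto
  have h_minus: "h v - h w = h (v - w)" if "v \<in> carrier_vec r" "w \<in> carrier_vec r" for v w
    using that f g
    by (intro eq_vecI) (auto simp: h_def scalar_prod_minus_distrib[of _ r] algebra_simps)
  have h_sq: "h v \<bullet> h v = v \<bullet> v - t * (a \<bullet> v) * (b \<bullet> v)" if v: "v \<in> carrier_vec r" for v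
  proof -
    have "h v \<bullet> h v = (v + (- (d * (f \<bullet> v))) \<cdot>\<^sub>v f) \<bullet> (v + (- (d * (f \<bullet> v))) \<cdot>\<^sub>v f)
        + vec 1 (\<lambda>_. sqrt c * (g \<bullet> v)) \<bullet> vec 1 (\<lambda>_. sqrt c * (g \<bullet> v))"
      unfolding h_def by (rule scalar_prod_append[of _ r _ 1]) (use v f in auto)
    also have "vec 1 (\<lambda>_. sqrt c * (g \<bullet> v)) \<bullet> vec 1 (\<lambda>_. sqrt c * (g \<bullet> v)) = c * (g \<bullet> v)\<^sup>2"
      using c0 by (simp add: scalar_prod_def power2_eq_square)
    also have "(v + (- (d * (f \<bullet> v))) \<cdot>\<^sub>v f) \<bullet> (v + (- (d * (f \<bullet> v))) \<cdot>\<^sub>v f)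
        = v \<bullet> v - (2 * d - d\<^sup>2 * (f \<bullet> f)) * (f \<bullet> v)\<^sup>2"
      using scalar_prod_lincomb_self[OF v f, of 1 "- (d * (f \<bullet> v))"] comm_scalar_prod[OF v f]
      by (simp add: power2_eq_square algebra_simps)
    also have "\<dots> = v \<bullet> v - c * (f \<bullet> v)\<^sup>2" unfolding d ..
    also have "v \<bullet> v - c * (f \<bullet> v)\<^sup>2 + c * (g \<bullet> v)\<^sup>2
        = v \<bullet> v - c * (4 * (N * M)) * (a \<bullet> v) * (b \<bullet> v)"
      unfolding f_def g_def scalar_prod_lincomb[OF a b v]
      by (simp add: power2_eq_square algebra_simps)
    also have "c * (4 * (N * M)) = t" unfolding c_def using NM by simp
    finally show ?thesis .
  qed
  have "generating_points n (r + 1) (\<lambda>i. h (p i)) D'"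
    unfolding generating_points_def eucl_norm_sq
    using p by (auto simp: h h_minus h_sq entries simp del: One_nat_def add_Suc_right)
  thus ?thesis unfolding is_EDM_def using D' by blast
qed

text \<open>Replacing \<open>b\<close> by \<open>- b\<close> and \<open>t\<close> by \<open>- t\<close> does not change the form and exchanges the two bounds.\<close>

lemma rank_two_modification_EDM:
  assumes p: "\<And>i. i < n \<Longrightarrow> p i \<in> carrier_vec r"
    and a: "a \<in> carrier_vec r" and b: "b \<in> carrier_vec r"
    and na: "0 < eucl_norm a" and nb: "0 < eucl_norm b"
    and t1: "t * (a \<bullet> b + eucl_norm a * eucl_norm b) \<le> 2"
    and t2: "t * (a \<bullet> b - eucl_norm a * eucl_norm b) \<le> 2"
    and D': "D' \<in> carrier_mat n n"
    and entries: "\<And>i j. i < n \<Longrightarrow> j < n \<Longrightarrow> D' $$ (i, j) =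
      (p i - p j) \<bullet> (p i - p j) - t * (a \<bullet> (p i - p j)) * (b \<bullet> (p i - p j))"
  shows "is_EDM n D'"
proof (cases "0 \<le> t")
  case True
  thus ?thesis using rank_two_modification_EDM_nonneg[OF p a b na nb _ t1 D' entries] by simp
next
  case False
  have nb': "eucl_norm (- b) = eucl_norm b"
    unfolding eucl_norm_def using b by simp
  have ab: "a \<bullet> (- b) = - (a \<bullet> b)" using a b by simp
  show ?thesis
  proof (rule rank_two_modification_EDM_nonneg[OF p a _ na, where b = "- b" and t = "- t"])
    show "- t * (a \<bullet> (- b) + eucl_norm a * eucl_norm (- b)) \<le> 2"
      using t2 unfolding nb' ab by (simp add: algebra_simps)
    fix i j assume ij: "i < n" "j < n"
    have "(- b) \<bullet> (p i - p j) = - (b \<bullet> (p i - p j))" using b p[OF ij(1)] p[OF ij(2)] by simp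
    thus "D' $$ (i, j) = (p i - p j) \<bullet> (p i - p j)
        - (- t) * (a \<bullet> (p i - p j)) * ((- b) \<bullet> (p i - p j))"
      unfolding entries[OF ij] by simp
  qed (use False b nb nb' D' in auto)
qed

text \<open>The form is tested on \<open>v = |b| a + s |a| b\<close>, where it is extremal.  The sign \<open>s\<close> treats both bounds
  at once; \<open>s (a \<bullet> b + s |a| |b|)\<close> is nonnegative because \<open>v \<bullet> v\<close> is a positive multiple of it.\<close>

lemma quadratic_form_bound:
  assumes a: "a \<in> carrier_vec r" and b: "b \<in> carrier_vec r"
    and na: "0 < eucl_norm a" and nb: "0 < eucl_norm b"
    and bound: "\<And>v. v \<in> carrier_vec r \<Longrightarrow> t * (a \<bullet> v) * (b \<bullet> v) \<le> v \<bullet> v"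
    and s: "s = 1 \<or> s = (- 1 :: real)"
    and ne: "a \<bullet> b + s * (eucl_norm a * eucl_norm b) \<noteq> 0"
  shows "t * (a \<bullet> b + s * (eucl_norm a * eucl_norm b)) \<le> 2"
proof -
  define N M where "N = eucl_norm a" and "M = eucl_norm b"
  define lam where "lam = a \<bullet> b + s * (N * M)"
  define v where "v = M \<cdot>\<^sub>v a + (s * N) \<cdot>\<^sub>v b"
  have NM: "0 < N" "0 < M" using na nb unfolding N_def M_def by auto
  have ss: "s * s = 1" using s by auto
  have v: "v \<in> carrier_vec r" unfolding v_def using a b by auto
  have aa: "a \<bullet> a = N\<^sup>2" "b \<bullet> b = M\<^sup>2" unfolding N_def M_def eucl_norm_sq by auto
  have av: "a \<bullet> v = N * (s * lam)" "b \<bullet> v = M * lam"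
    unfolding v_def scalar_prod_lincomb_right[OF a b a] scalar_prod_lincomb_right[OF a b b] aa
      comm_scalar_prod[OF b a] lam_def
    using s by (auto simp: power2_eq_square algebra_simps)
  have vv: "v \<bullet> v = 2 * (N * M) * (s * lam)"
    unfolding v_def scalar_prod_lincomb_self[OF a b] aa lam_def
    using s by (auto simp: power2_eq_square algebra_simps)
  have l: "lam \<noteq> 0" using ne unfolding lam_def N_def M_def .
  have "s * lam \<noteq> 0" using l s by auto
  moreover have "0 \<le> 2 * (N * M) * (s * lam)" using scalar_prod_self_ge_0[of v] vv by simp
  moreover have NM0: "0 < N * M" using NM by simp
  ultimately have "0 < s * lam"
    using zero_le_mult_iff[of "2 * (N * M)" "s * lam"] by linarith
  hence pos: "0 < N * M * (s * lam)" by (rule mult_pos_pos[OF NM0])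
  have "(N * M * (s * lam)) * (t * lam) \<le> (N * M * (s * lam)) * 2"
    using bound[OF v] unfolding av vv by (simp add: algebra_simps)
  hence "t * lam \<le> 2" using pos by (simp only: mult_le_cancel_left_pos)
  thus ?thesis unfolding lam_def N_def M_def .
qed

section \<open>The yielding interval\<close>

lemma unit_sym_mat_quadratic_form:
  assumes x: "x \<in> carrier_vec n" and kl: "k < n" "l < n" "k \<noteq> l"
  shows "x \<bullet> (unit_sym_mat n k l *\<^sub>v x) = 2 * (x $ k * x $ l)"
proof -
  have E: "unit_sym_mat n k l \<in> carrier_mat n n" by (simp add: unit_sym_mat_def)
  have "unit_sym_mat n k l *\<^sub>v x = x $ l \<cdot>\<^sub>v unit_vec n k + x $ k \<cdot>\<^sub>v unit_vec n l"
  proof (rule eq_vecI)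
    fix i assume "i < dim_vec (x $ l \<cdot>\<^sub>v unit_vec n k + x $ k \<cdot>\<^sub>v unit_vec n l)"
    hence i: "i < n" by simp
    have "(unit_sym_mat n k l *\<^sub>v x) $ i
        = (\<Sum>j<n. (if j = l then if i = k then x $ j else 0 else 0)
            + (if j = k then if i = l then x $ j else 0 else 0))"
    proof -
      have "(unit_sym_mat n k l *\<^sub>v x) $ i = (\<Sum>j<n. unit_sym_mat n k l $$ (i, j) * x $ j)"
        using i E x by (simp add: scalar_prod_def lessThan_atLeast0)
      also have "\<dots> = (\<Sum>j<n. (if j = l then if i = k then x $ j else 0 else 0)
            + (if j = k then if i = l then x $ j else 0 else 0))"
        using i kl by (intro sum.cong refl) (auto simp: unit_sym_mat_def)
      finally show ?thesis .
    qed
    also have "\<dots> = (if i = k then x $ l else 0) + (if i = l then x $ k else 0)"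
      using kl by (simp add: sum.distrib)
    finally show "(unit_sym_mat n k l *\<^sub>v x) $ i
        = (x $ l \<cdot>\<^sub>v unit_vec n k + x $ k \<cdot>\<^sub>v unit_vec n l) $ i"
      using i kl by auto
  qed (use E in auto)
  thus ?thesis using x kl by (simp add: scalar_prod_lincomb_right[of _ n])
qed

theorem theorem4p2:
  fixes n r k l :: nat and D P Z S :: "real mat" and lam1 lamr :: real
  assumes "n \<ge> 4"
    and "is_EDM n D"
    and "embedding_dim n D r"
    and "r \<le> n - 2"
    and "is_configuration_mat n r D P"
    and "transpose_mat P *\<^sub>v ones_vec n = 0\<^sub>v r"
    and "is_Gale_mat n r P Z"
    and "S = P * the (mat_inverse (transpose_mat P * P))"
    and "k < n" and "l < n" and "k \<noteq> l"
    and "row Z k = 0\<^sub>v (n - r - 1)" and "row Z l = 0\<^sub>v (n - r - 1)"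
    and "lam1 = row S k \<bullet> row S l + eucl_norm (row S k) * eucl_norm (row S l)"
    and "lamr = row S k \<bullet> row S l - eucl_norm (row S k) * eucl_norm (row S l)"
  shows "lam1 \<noteq> 0 \<and> lamr \<noteq> 0 \<and> is_yielding_interval n D k l {2 / lamr .. 2 / lam1}"
proof -
  let ?e = "ones_vec n"
  let ?E = "unit_sym_mat n k l"
  define Q where "Q = the (mat_inverse (transpose_mat P * P))"
  define a b where "a = row S k" and "b = row S l"
  have P: "P \<in> carrier_mat n r" using assms(5) unfolding is_configuration_mat_def by auto
  have PT: "transpose_mat P \<in> carrier_mat r n" using P by simp
  have Dc: "D \<in> carrier_mat n n" using assms(2) unfolding is_EDM_def by auto
  have Ec: "?E \<in> carrier_mat n n" by (simp add: unit_sym_mat_def)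
  have e: "?e \<in> carrier_vec n" by (simp add: ones_vec_def)
  have "2 \<le> n" using assms(1) by simp
  note inj = configuration_injective[OF P assms(4) this assms(7)]
  note Q = injective_imp_gram_inverse[OF P inj, folded Q_def]
  have S: "S = P * Q" using assms(8) Q_def by simp
  have Sc: "S \<in> carrier_mat n r" unfolding S using P Q(1) by auto
  have a: "a \<in> carrier_vec r" and b: "b \<in> carrier_vec r"
    unfolding a_def b_def
    using row_carrier_vec[OF assms(9) Sc] row_carrier_vec[OF assms(10) Sc] by auto
  have Pa: "P *\<^sub>v a = unit_vec n k - (1 / real n) \<cdot>\<^sub>v ?e"
    unfolding a_def S
    by (rule zero_Gale_row_imp_unit_vec_in_range[OF P assms(7,6) Q(1,3) assms(9,12)])
  have Pb: "P *\<^sub>v b = unit_vec n l - (1 / real n) \<cdot>\<^sub>v ?e"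
    unfolding b_def S
    by (rule zero_Gale_row_imp_unit_vec_in_range[OF P assms(7,6) Q(1,3) assms(10,13)])
  have pa: "a \<bullet> row P i = (if i = k then 1 else 0) - 1 / real n"
    and pb: "b \<bullet> row P i = (if i = l then 1 else 0) - 1 / real n" if i: "i < n" for i
  proof -
    have ri: "row P i \<in> carrier_vec r" using P i by auto
    show "a \<bullet> row P i = (if i = k then 1 else 0) - 1 / real n"
      using arg_cong[OF Pa, of "\<lambda>v. v $ i"] i P assms(9) comm_scalar_prod[OF a ri]
      by (auto simp: ones_vec_def)
    show "b \<bullet> row P i = (if i = l then 1 else 0) - 1 / real n"
      using arg_cong[OF Pb, of "\<lambda>v. v $ i"] i P assms(10) comm_scalar_prod[OF b ri]
      by (auto simp: ones_vec_def)
  qed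
  \<comment> \<open>If \<open>x a + y b = 0\<close>, then \<open>x e\<^sub>k + y e\<^sub>l = (x + y) e / n\<close>; an index other than \<open>k\<close> and \<open>l\<close>
    shows \<open>x + y = 0\<close>.\<close>
  have indep: "x = 0 \<and> y = 0" if z: "x \<cdot>\<^sub>v a + y \<cdot>\<^sub>v b = 0\<^sub>v r" for x y
  proof -
    have "card ({..<n} - {k, l}) > 0"
      using assms(1,9-11) by (subst card_Diff_subset) auto
    then obtain m where "m \<in> {..<n} - {k, l}" by (metis card_gt_0_iff ex_in_conv)
    hence m: "m < n" "m \<noteq> k" "m \<noteq> l" by auto
    have eq: "x * (a \<bullet> row P i) + y * (b \<bullet> row P i) = 0" if i: "i < n" for i
      using scalar_prod_lincomb[OF a b, of "row P i" x y] z P i by auto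
    have "x * (- (1 / real n)) + y * (- (1 / real n)) = 0"
      using eq[OF m(1)] unfolding pa[OF m(1)] pb[OF m(1)] using m by simp
    hence "(x + y) * (- (1 / real n)) = 0" by (simp only: distrib_right)
    hence sum: "x + y = 0" using assms(1) by simp
    have "x * (1 - 1 / real n) + y * (- (1 / real n)) = 0"
      using eq[OF assms(9)] unfolding pa[OF assms(9)] pb[OF assms(9)] using assms(11) by simp
    hence "x - (x + y) * (1 / real n) = 0" by (simp only: algebra_simps)
    thus ?thesis using sum by simp
  qed
  note CS = strict_Cauchy_Schwarz[OF a b indep]
  have lam1: "lam1 = a \<bullet> b + eucl_norm a * eucl_norm b"
    and lamr: "lamr = a \<bullet> b - eucl_norm a * eucl_norm b"
    using assms(14,15) unfolding a_def b_def by auto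
  have l1: "0 < lam1" and lr: "lamr < 0" unfolding lam1 lamr using CS(3) by auto
  have gp: "generating_points n r (row P) D"
    by (rule configuration_generating_points[OF assms(2,5)])
  have "is_EDM n (D + t \<cdot>\<^sub>m ?E) \<longleftrightarrow> t * lam1 \<le> 2 \<and> t * lamr \<le> 2" for t
  proof
    assume edm: "is_EDM n (D + t \<cdot>\<^sub>m ?E)"
    have bound: "t * (a \<bullet> v) * (b \<bullet> v) \<le> v \<bullet> v" if v: "v \<in> carrier_vec r" for v
    proof -
      \<comment> \<open>\<open>S = P (P\<^sup>T P)\<^sup>-\<^sup>1\<close> is a right inverse of \<open>P\<^sup>T\<close>, and the entries \<open>k\<close>, \<open>l\<close> of \<open>S v\<close> are
        \<open>a \<bullet> v\<close> and \<open>b \<bullet> v\<close>.\<close>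
      let ?x = "S *\<^sub>v v"
      have x: "?x \<in> carrier_vec n" using Sc v by auto
      have Qv: "Q *\<^sub>v v \<in> carrier_vec r" using Q(1) v by auto
      have xP: "?x = P *\<^sub>v (Q *\<^sub>v v)" unfolding S by (rule assoc_mult_mat_vec[OF P Q(1) v])
      have ex: "?e \<bullet> ?x = 0"
        unfolding xP using transpose_vec_mult_scalar[OF P Qv e] assms(6) Qv by simp
      have "transpose_mat P *\<^sub>v ?x = (transpose_mat P * P * Q) *\<^sub>v v"
        unfolding xP assoc_mult_mat_vec[OF PT P Qv, symmetric]
        by (rule assoc_mult_mat_vec[OF mult_carrier_mat[OF PT P] Q(1) v, symmetric])
      also have "\<dots> = 1\<^sub>m r *\<^sub>v v" by (rule arg_cong[OF Q(2)])
      finally have Px: "transpose_mat P *\<^sub>v ?x = v" using v by simp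
      have xk: "?x $ k = a \<bullet> v" "?x $ l = b \<bullet> v"
        unfolding a_def b_def using Sc assms(9,10) by auto
      have "(D + t \<cdot>\<^sub>m ?E) *\<^sub>v ?x = D *\<^sub>v ?x + t \<cdot>\<^sub>v (?E *\<^sub>v ?x)"
        using Dc Ec x
        by (simp add: add_mult_distrib_mat_vec[OF Dc _ x] smult_mat_mult_vec[OF Ec x])
      hence "?x \<bullet> ((D + t \<cdot>\<^sub>m ?E) *\<^sub>v ?x) = ?x \<bullet> (D *\<^sub>v ?x) + t * (?x \<bullet> (?E *\<^sub>v ?x))"
        using Dc Ec x by (simp add: scalar_prod_add_distrib[of _ n])
      also have "\<dots> = - 2 * (v \<bullet> v) + 2 * (t * (a \<bullet> v) * (b \<bullet> v))"
        unfolding configuration_quadratic_form[OF Dc assms(5) x ex]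
          unit_sym_mat_quadratic_form[OF x assms(9-11)] Px xk by simp
      finally show ?thesis using EDM_negative_type[OF edm x ex] by simp
    qed
    show "t * lam1 \<le> 2 \<and> t * lamr \<le> 2"
      using quadratic_form_bound[OF a b CS(1,2) bound, of 1]
        quadratic_form_bound[OF a b CS(1,2) bound, of "- 1"] l1 lr
      unfolding lam1 lamr by simp
  next
    assume t: "t * lam1 \<le> 2 \<and> t * lamr \<le> 2"
    show "is_EDM n (D + t \<cdot>\<^sub>m ?E)"
    proof (rule rank_two_modification_EDM[OF _ a b CS(1,2), of n "row P" t])
      fix i j assume ij: "i < n" "j < n"
      have r: "row P i \<in> carrier_vec r" "row P j \<in> carrier_vec r" using P ij by auto
      have "D $$ (i, j) = (row P i - row P j) \<bullet> (row P i - row P j)"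
        using gp ij unfolding generating_points_def eucl_norm_sq by auto
      moreover have "?E $$ (i, j) = - ((a \<bullet> (row P i - row P j)) * (b \<bullet> (row P i - row P j)))"
        using ij a b r assms(11)
        by (auto simp: unit_sym_mat_def scalar_prod_minus_distrib[of _ r] pa pb)
      ultimately show "(D + t \<cdot>\<^sub>m ?E) $$ (i, j) = (row P i - row P j) \<bullet> (row P i - row P j)
          - t * (a \<bullet> (row P i - row P j)) * (b \<bullet> (row P i - row P j))"
        using ij Dc Ec by simp
    qed (use t P Dc Ec in \<open>auto simp: lam1 lamr\<close>)
  qed
  moreover have "t * lam1 \<le> 2 \<longleftrightarrow> t \<le> 2 / lam1" "t * lamr \<le> 2 \<longleftrightarrow> 2 / lamr \<le> t" for t
    using l1 lr by (simp_all add: pos_le_divide_eq neg_divide_le_eq)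
  ultimately have "is_yielding_interval n D k l {2 / lamr .. 2 / lam1}"
    unfolding is_yielding_interval_def by blast
  thus ?thesis using l1 lr by simp
qed

end
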